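(* Let $0<b<1<a$ and $\mathcal{C}=\{f\in\mathcal{F}:\sigma_{j+r}(f)\le ab^r\sigma_j(f)\ \forall j,r\in\mathbb{N}\}$. Assume: (a) there are $0<\beta,\gamma<1\le\alpha$ with $\alpha^{-1}\beta^r\Lambda_j\le\Lambda_{j+r}\le\alpha\gamma^r\Lambda_j$ for all $j,r\in\mathbb{N}_0$; (b) $\displaystyle\sup_{j\in\mathbb{N}}\frac{\lambda_{\boldsymbol{k}_{n_{j-1}+1}}}{\lambda_{\boldsymbol{k}_{n_j}}}\le S_1<\infty$; (c) $\displaystyle\inf_{j\in\mathbb{N}}\ \min_{\mathcal{J}\subset\mathbb{K}:\,\mathrm{card}(\mathcal{J})\le n_j}\ \max_{0\le l\le j+1}\frac{\mathrm{card}(\mathcal{K}_l\setminus\mathcal{J})}{\mathrm{card}(\mathcal{K}_l)}\ge S_2>0$. Let $\mathrm{ALG}$ be the adaptive algorithm that, given $f$ and $\varepsilon>0$, returns $\mathrm{APP}(f,n_j)$ for the smallest $j\in\mathbb{N}$ with $\mathrm{ERR}_j(f)\le\varepsilon$. Then $\mathrm{ALG}$ is essentially optimal for $\mathcal{C}$: there exist fixed positive $\omega,\varepsilon_{\max},R_{\min}$ such that $$\mathrm{COST}(\mathrm{ALG},\mathcal{C},\varepsilon,R)\le\mathrm{COMP}(\mathcal{A}(\mathcal{C}),\omega\varepsilon,R)\qquad\forall\,\varepsilon\in(0,\varepsilon_{\max}],\ R\in[R_{\min},\infty).$$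
   Context: Setting. $\mathbb{K}$ is a countably infinite index set of "wavenumbers" and $1\le\tau\le\rho\le\infty$. The weights $\boldsymbol{\lambda}=(\lambda_{\boldsymbol{k}})_{\boldsymbol{k}\in\mathbb{K}}$ are positive, and $\mathbb{K}=\{\boldsymbol{k}_1,\boldsymbol{k}_2,\dots\}$ is enumerated so that $\lambda_{\boldsymbol{k}_1}\ge\lambda_{\boldsymbol{k}_2}\ge\cdots>0$. The number $\rho'\in[\tau,\infty]$ is defined by $1/\rho+1/\rho'=1/\tau$, and it is assumed throughout that $\|\boldsymbol{\lambda}\|_{\rho'}<\infty$. Here $\|\cdot\|_p$ is the $\ell^p$ norm of a sequence, $\mathbb{N}=\{1,2,\dots\}$, and $\mathrm{card}$ denotes cardinality. The input and output Banach spaces, with bases $\{u_{\boldsymbol{k}}\}$ and $\{v_{\boldsymbol{k}}\}$ (elements are identified with their coefficient sequences), are $$\mathcal{F}=\Bigl\{f=\sum_{\boldsymbol{k}\in\mathbb{K}}\widehat f(\boldsymbol{k})u_{\boldsymbol{k}}:\|f\|_{\mathcal{F}}:=\bigl\|(\widehat f(\boldsymbol{k})/\lambda_{\boldsymbol{k}})_{\boldsymbol{k}\in\mathbb{K}}\bigr\|_\rho<\infty\Bigr\},\quad \mathcal{G}=\Bigl\{g=\sum_{\boldsymbol{k}\in\mathbb{K}}\widehat g(\boldsymbol{k})v_{\boldsymbol{k}}:\|g\|_{\mathcal{G}}:=\bigl\|(\widehat g(\boldsymbol{k}))_{\boldsymbol{k}\in\mathbb{K}}\bigr\|_\tau<\infty\Bigr\}.$$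 The solution operator is $\mathrm{SOL}:\mathcal{F}\to\mathcal{G}$, $\mathrm{SOL}(f)=\sum_{\boldsymbol{k}}\widehat f(\boldsymbol{k})v_{\boldsymbol{k}}$. $\mathcal{B}_R=\{f\in\mathcal{F}:\|f\|_{\mathcal{F}}\le R\}$. $\mathrm{APP}(f,0)=0$, $\mathrm{APP}(f,n)=\sum_{i=1}^n\widehat f(\boldsymbol{k}_i)v_{\boldsymbol{k}_i}$. Let $(n_j)_{j\ge0}$ be a strictly increasing sequence of non-negative integers, $n_{-1}=0$, and for $j\in\mathbb{N}_0$ let $\mathcal{K}_j=\{\boldsymbol{k}_{n_{j-1}+1},\dots,\boldsymbol{k}_{n_j}\}$, $$\sigma_j(f)=\bigl\|(\widehat f(\boldsymbol{k})/\lambda_{\boldsymbol{k}})_{\boldsymbol{k}\in\mathcal{K}_j}\bigr\|_\rho,\qquad \Lambda_j=\bigl\|(\lambda_{\boldsymbol{k}})_{\boldsymbol{k}\in\mathcal{K}_j}\bigr\|_{\rho'},\qquad \mathrm{ERR}_j(f)=a\,\sigma_j(f)\,\bigl\|(b^r\Lambda_{j+r})_{r=1}^\infty\bigr\|_\tau\ (j\in\mathbb{N}).$$ For $\mathcal{C}\subseteq\mathcal{F}$, $\mathcal{A}(\mathcal{C})$ is the set of all (deterministic) algorithms that use only finitely many series coefficients of the input (the number and choice of which may depend adaptively on the coefficient values already observed and on $\varepsilon$) and satisfy $\|\mathrm{SOL}(f)-\mathrm{ALG}(f,\varepsilon)\|_{\mathcal{G}}\le\varepsilon$ for all $\varepsilon>0$,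 $f\in\mathcal{C}$. $\mathrm{COST}(\mathrm{ALG},f,\varepsilon)$ is the number of series coefficients used by $\mathrm{ALG}(f,\varepsilon)$, $$\mathrm{COST}(\mathrm{ALG},\mathcal{C},\varepsilon,R)=\max_{f\in\mathcal{C}\cap\mathcal{B}_R}\mathrm{COST}(\mathrm{ALG},f,\varepsilon),\qquad \mathrm{COMP}(\mathcal{A}(\mathcal{C}),\varepsilon,R)=\min_{\mathrm{ALG}\in\mathcal{A}(\mathcal{C})}\mathrm{COST}(\mathrm{ALG},\mathcal{C},\varepsilon,R).$$ *)

theory Defs
  imports "HOL-Analysis.Analysis"
begin

text \<open>The \<open>\<ell>\<^sup>p\<close> norm of the family \<open>x\<close> restricted to \<open>A\<close>, for \<open>0 < p \<le> \<infinity>\<close>; it is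
  \<open>\<infinity>\<close> exactly if the family is not in \<open>\<ell>\<^sup>p\<close>, and \<open>0\<close> if \<open>A\<close> is empty.\<close>

definition lp_enorm :: "ennreal \<Rightarrow> 'i set \<Rightarrow> ('i \<Rightarrow> 'c::real_normed_vector) \<Rightarrow> ennreal" where
  "lp_enorm p A x =
    (if p = \<infinity> then (SUP i\<in>A. ennreal (norm (x i)))
     else if (\<lambda>i. norm (x i) powr enn2real p) summable_on A
     then ennreal ((\<Sum>\<^sub>\<infinity>i\<in>A. norm (x i) powr enn2real p) powr (1 / enn2real p))
     else \<infinity>)"

text \<open>The real-valued version; only meaningful where \<open>lp_enorm\<close> is finite.\<close>

definition lp_norm :: "ennreal \<Rightarrow> 'i set \<Rightarrow> ('i \<Rightarrow> 'c::real_normed_vector) \<Rightarrow> real" where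
  "lp_norm p A x = enn2real (lp_enorm p A x)"

text \<open>Elements of the input and output spaces are identified with their families of series
  coefficients, indexed by the type \<open>'k\<close> of wavenumbers. The scalars \<open>'c\<close> may be real or
  complex.\<close>

definition input_norm :: "ennreal \<Rightarrow> ('k \<Rightarrow> real) \<Rightarrow> ('k \<Rightarrow> 'c::real_normed_vector) \<Rightarrow> ennreal" where
  "input_norm \<rho> lam f = lp_enorm \<rho> UNIV (\<lambda>x. f x /\<^sub>R lam x)"

definition input_space :: "ennreal \<Rightarrow> ('k \<Rightarrow> real) \<Rightarrow> ('k \<Rightarrow> 'c::real_normed_vector) set" where
  "input_space \<rho> lam = {f. input_norm \<rho> lam f < \<infinity>}"

definition input_ball ::
    "ennreal \<Rightarrow> ('k \<Rightarrow> real) \<Rightarrow> real \<Rightarrow> ('k \<Rightarrow> 'c::real_normed_vector) set" where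
  "input_ball \<rho> lam R = {f \<in> input_space \<rho> lam. input_norm \<rho> lam f \<le> ennreal R}"

definition output_norm :: "ennreal \<Rightarrow> ('k \<Rightarrow> 'c::real_normed_vector) \<Rightarrow> ennreal" where
  "output_norm \<tau> g = lp_enorm \<tau> UNIV g"

text \<open>The solution operator maps the input with coefficients \<open>f\<close> (with respect to the input basis)
  to the output with the same coefficients (with respect to the output basis).\<close>

definition SOL :: "('k \<Rightarrow> 'c) \<Rightarrow> ('k \<Rightarrow> 'c)" where
  "SOL f = (\<lambda>x. f x)"

text \<open>Below, \<open>k\<close> enumerates the wavenumbers as \<open>k 1, k 2, \<dots>\<close>; the value \<open>k 0\<close> is irrelevant.\<close>

definition APP :: "(nat \<Rightarrow> 'k) \<Rightarrow> ('k \<Rightarrow> 'c::real_normed_vector) \<Rightarrow> nat \<Rightarrow> ('k \<Rightarrow> 'c)" where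
  "APP k f m = (\<lambda>x. if x \<in> k ` {1..m} then f x else 0)"

definition block :: "(nat \<Rightarrow> 'k) \<Rightarrow> (nat \<Rightarrow> nat) \<Rightarrow> nat \<Rightarrow> 'k set" where
  "block k n j = k ` {(if j = 0 then 0 else n (j - 1)) + 1..n j}"

definition sigma :: "ennreal \<Rightarrow> ('k \<Rightarrow> real) \<Rightarrow> (nat \<Rightarrow> 'k) \<Rightarrow> (nat \<Rightarrow> nat) \<Rightarrow>
    nat \<Rightarrow> ('k \<Rightarrow> 'c::real_normed_vector) \<Rightarrow> real" where
  "sigma \<rho> lam k n j f = lp_norm \<rho> (block k n j) (\<lambda>x. f x /\<^sub>R lam x)"

definition Lam :: "ennreal \<Rightarrow> ('k \<Rightarrow> real) \<Rightarrow> (nat \<Rightarrow> 'k) \<Rightarrow> (nat \<Rightarrow> nat) \<Rightarrow> nat \<Rightarrow> real" where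
  "Lam \<rho>' lam k n j = lp_norm \<rho>' (block k n j) lam"

text \<open>If the \<open>\<ell>\<close>-\<open>\<rho>'\<close> norm of \<open>lam\<close> is finite and \<open>0 < b < 1\<close>, then the tail norm below is finite.\<close>

definition ERR :: "real \<Rightarrow> real \<Rightarrow> ennreal \<Rightarrow> ennreal \<Rightarrow> ennreal \<Rightarrow> ('k \<Rightarrow> real) \<Rightarrow> (nat \<Rightarrow> 'k) \<Rightarrow>
    (nat \<Rightarrow> nat) \<Rightarrow> nat \<Rightarrow> ('k \<Rightarrow> 'c::real_normed_vector) \<Rightarrow> real" where
  "ERR a b \<tau> \<rho> \<rho>' lam k n j f =
    a * sigma \<rho> lam k n j f * lp_norm \<tau> {1..} (\<lambda>r. b ^ r * Lam \<rho>' lam k n (j + r))"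

definition decay_cone :: "real \<Rightarrow> real \<Rightarrow> ennreal \<Rightarrow> ('k \<Rightarrow> real) \<Rightarrow> (nat \<Rightarrow> 'k) \<Rightarrow> (nat \<Rightarrow> nat) \<Rightarrow>
    ('k \<Rightarrow> 'c::real_normed_vector) set" where
  "decay_cone a b \<rho> lam k n =
    {f \<in> input_space \<rho> lam.
      \<forall>j\<ge>1. \<forall>r\<ge>1. sigma \<rho> lam k n (j + r) f \<le> a * b ^ r * sigma \<rho> lam k n j f}"

text \<open>A deterministic adaptive algorithm: for each tolerance, a rule that maps the list of
  observations made so far (pairs of a wavenumber and the coefficient found there) either to
  \<open>Inl x\<close> (observe the coefficient at wavenumber \<open>x\<close> next) or to \<open>Inr g\<close> (stop and return \<open>g\<close>).\<close>

type_synonym ('k, 'c) algorithm = "real \<Rightarrow> ('k \<times> 'c) list \<Rightarrow> 'k + ('k \<Rightarrow> 'c)"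

primrec observations :: "('k, 'c) algorithm \<Rightarrow> ('k \<Rightarrow> 'c) \<Rightarrow> real \<Rightarrow> nat \<Rightarrow> ('k \<times> 'c) list" where
  "observations A f \<epsilon> 0 = []"
| "observations A f \<epsilon> (Suc m) =
    (case A \<epsilon> (observations A f \<epsilon> m) of
      Inl x \<Rightarrow> observations A f \<epsilon> m @ [(x, f x)]
    | Inr g \<Rightarrow> observations A f \<epsilon> m)"

definition halts_at :: "('k, 'c) algorithm \<Rightarrow> ('k \<Rightarrow> 'c) \<Rightarrow> real \<Rightarrow> nat \<Rightarrow> bool" where
  "halts_at A f \<epsilon> m \<longleftrightarrow> (\<exists>g. A \<epsilon> (observations A f \<epsilon> m) = Inr g)"

definition halts :: "('k, 'c) algorithm \<Rightarrow> ('k \<Rightarrow> 'c) \<Rightarrow> real \<Rightarrow> bool" where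
  "halts A f \<epsilon> \<longleftrightarrow> (\<exists>m. halts_at A f \<epsilon> m)"

definition final_observations ::
    "('k, 'c) algorithm \<Rightarrow> ('k \<Rightarrow> 'c) \<Rightarrow> real \<Rightarrow> ('k \<times> 'c) list" where
  "final_observations A f \<epsilon> = observations A f \<epsilon> (LEAST m. halts_at A f \<epsilon> m)"

definition alg_output :: "('k, 'c) algorithm \<Rightarrow> ('k \<Rightarrow> 'c) \<Rightarrow> real \<Rightarrow> ('k \<Rightarrow> 'c)" where
  "alg_output A f \<epsilon> = projr (A \<epsilon> (final_observations A f \<epsilon>))"

definition alg_cost :: "('k, 'c) algorithm \<Rightarrow> ('k \<Rightarrow> 'c) \<Rightarrow> real \<Rightarrow> enat" where
  "alg_cost A f \<epsilon> =
    (if halts A f \<epsilon> then enat (card (fst ` set (final_observations A f \<epsilon>))) else \<infinity>)"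

definition admissible ::
    "ennreal \<Rightarrow> ('k \<Rightarrow> 'c::real_normed_vector) set \<Rightarrow> ('k, 'c) algorithm set" where
  "admissible \<tau> C =
    {A. \<forall>\<epsilon>>0. \<forall>f\<in>C. halts A f \<epsilon> \<and>
      output_norm \<tau> (\<lambda>x. SOL f x - alg_output A f \<epsilon> x) \<le> ennreal \<epsilon>}"

text \<open>The maximum and the minimum are taken in the extended naturals, where every nonempty set has
  a minimum, and every nonempty bounded set a maximum; the worst-case cost is \<open>\<infinity>\<close> if the costs
  are unbounded.\<close>

definition COST :: "ennreal \<Rightarrow> ('k \<Rightarrow> real) \<Rightarrow> ('k, 'c::real_normed_vector) algorithm \<Rightarrow>
    ('k \<Rightarrow> 'c) set \<Rightarrow> real \<Rightarrow> real \<Rightarrow> enat" where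
  "COST \<rho> lam A C \<epsilon> R = (SUP f\<in>C \<inter> input_ball \<rho> lam R. alg_cost A f \<epsilon>)"

definition COMP :: "ennreal \<Rightarrow> ennreal \<Rightarrow> ('k \<Rightarrow> real) \<Rightarrow> ('k \<Rightarrow> 'c::real_normed_vector) set \<Rightarrow>
    real \<Rightarrow> real \<Rightarrow> enat" where
  "COMP \<tau> \<rho> lam C \<epsilon> R = (INF A\<in>admissible \<tau> C. COST \<rho> lam A C \<epsilon> R)"

text \<open>The adaptive algorithm observes the coefficients at \<open>k 1, k 2, \<dots>\<close> in turn. After \<open>n j\<close>
  observations, \<open>j \<ge> 1\<close>, it stops if \<open>ERR\<^sub>j \<le> \<epsilon>\<close>; the error bound involves only the coefficients in
  \<open>block k n j\<close>, all of which have been observed by then. The unobserved coefficients are filled up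
  by \<open>0\<close>. The lemmas at the end confirm that this returns the intended approximation.\<close>

definition known_part :: "('k \<times> 'c) list \<Rightarrow> ('k \<Rightarrow> 'c::zero)" where
  "known_part h = (\<lambda>x. case map_of h x of None \<Rightarrow> 0 | Some y \<Rightarrow> y)"

definition ALG :: "real \<Rightarrow> real \<Rightarrow> ennreal \<Rightarrow> ennreal \<Rightarrow> ennreal \<Rightarrow> ('k \<Rightarrow> real) \<Rightarrow> (nat \<Rightarrow> 'k) \<Rightarrow>
    (nat \<Rightarrow> nat) \<Rightarrow> ('k, 'c::real_normed_vector) algorithm" where
  "ALG a b \<tau> \<rho> \<rho>' lam k n \<epsilon> h =
    (if \<exists>j\<ge>1. n j = length h \<and> ERR a b \<tau> \<rho> \<rho>' lam k n j (known_part h) \<le> \<epsilon>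
     then Inr (APP k (known_part h) (length h))
     else Inl (k (length h + 1)))"

lemma lp_norm_cong:
  assumes "\<And>i. i \<in> A \<Longrightarrow> x i = y i"
  shows "lp_norm p A x = lp_norm p A y"
proof -
  have "(\<Sum>\<^sub>\<infinity>i\<in>A. norm (x i) powr q) = (\<Sum>\<^sub>\<infinity>i\<in>A. norm (y i) powr q)" for q
    using assms by (intro infsum_cong) auto
  moreover have "((\<lambda>i. norm (x i) powr q) summable_on A) = ((\<lambda>i. norm (y i) powr q) summable_on A)" for q
    using assms by (intro summable_on_cong) auto
  moreover have "(SUP i\<in>A. ennreal (norm (x i))) = (SUP i\<in>A. ennreal (norm (y i)))"
    using assms by (intro SUP_cong) auto
  ultimately show ?thesis
    unfolding lp_norm_def lp_enorm_def by presburger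
qed

lemma ERR_cong:
  assumes "\<And>x. x \<in> block k n j \<Longrightarrow> f x = g x"
  shows "ERR a b \<tau> \<rho> \<rho>' lam k n j f = ERR a b \<tau> \<rho> \<rho>' lam k n j g"
proof -
  have "sigma \<rho> lam k n j f = sigma \<rho> lam k n j g"
    unfolding sigma_def using assms by (intro lp_norm_cong) simp
  then show ?thesis by (simp add: ERR_def)
qed

lemma known_part_prefix:
  "known_part (map (\<lambda>i. (k i, f (k i))) [1..<Suc m]) = (\<lambda>x. if x \<in> k ` {1..m} then f x else 0)"
  (is "known_part ?h = _")
proof -
  have h: "?h = map (\<lambda>x. (x, f x)) (map k [1..<Suc m])" by (simp add: comp_def)
  have s: "set (map k [1..<Suc m]) = k ` {1..m}"
    by (simp add: atLeastLessThanSuc_atLeastAtMost del: upt_Suc)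
  have "map_of ?h = (\<lambda>x. if x \<in> k ` {1..m} then Some (f x) else None)"
    unfolding h map_of_map_restrict s by (auto simp: restrict_map_def)
  then show ?thesis
    unfolding known_part_def by (intro ext) (simp del: upt_Suc)
qed

lemma ALG_run:
  fixes f :: "'k \<Rightarrow> 'c::real_normed_vector"
  assumes k: "bij_betw k {1..} UNIV" and n: "strict_mono n"
    and ex: "\<exists>j\<ge>1. ERR a b \<tau> \<rho> \<rho>' lam k n j f \<le> \<epsilon>"
  defines "J \<equiv> LEAST j. 1 \<le> j \<and> ERR a b \<tau> \<rho> \<rho>' lam k n j f \<le> \<epsilon>"
  shows ALG_halts: "halts (ALG a b \<tau> \<rho> \<rho>' lam k n) f \<epsilon>"
    and ALG_output: "alg_output (ALG a b \<tau> \<rho> \<rho>' lam k n) f \<epsilon> = APP k f (n J)"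
    and ALG_cost: "alg_cost (ALG a b \<tau> \<rho> \<rho>' lam k n) f \<epsilon> = enat (n J)"
proof -
  let ?A = "ALG a b \<tau> \<rho> \<rho>' lam k n :: ('k, 'c) algorithm"
  let ?E = "\<lambda>j. ERR a b \<tau> \<rho> \<rho>' lam k n j f"
  let ?h = "\<lambda>m. map (\<lambda>i. (k i, f (k i))) [1..<Suc m]"
  have J: "1 \<le> J" "?E J \<le> \<epsilon>"
    using LeastI_ex[of "\<lambda>j. 1 \<le> j \<and> ?E j \<le> \<epsilon>"] ex unfolding J_def by blast+
  have J_least: "J \<le> j" if "1 \<le> j" "?E j \<le> \<epsilon>" for j
    unfolding J_def using that by (intro Least_le) simp
  have E: "ERR a b \<tau> \<rho> \<rho>' lam k n j (known_part (?h (n j))) = ?E j" for j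
    unfolding known_part_prefix by (rule ERR_cong) (auto simp: block_def)
  have go: "?A \<epsilon> (?h m) = Inl (k (Suc m))" if "m < n J" for m
  proof -
    have "\<not> (1 \<le> j \<and> n j = m \<and> ERR a b \<tau> \<rho> \<rho>' lam k n j (known_part (?h m)) \<le> \<epsilon>)" for j
    proof
      assume j: "1 \<le> j \<and> n j = m \<and> ERR a b \<tau> \<rho> \<rho>' lam k n j (known_part (?h m)) \<le> \<epsilon>"
      then have "J \<le> j" using E[of j] J_least[of j] by metis
      then have "n J \<le> n j" using n by (simp add: strict_mono_less_eq)
      then show False using j that by simp
    qed
    then show ?thesis by (simp add: ALG_def del: upt_Suc)
  qed
  have stop: "?A \<epsilon> (?h (n J)) = Inr (APP k (known_part (?h (n J))) (n J))"
    using J E[of J] by (auto simp: ALG_def simp del: upt_Suc)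
  have obs: "observations ?A f \<epsilon> m = ?h m" if "m \<le> n J" for m
    using that
  proof (induction m)
    case (Suc m)
    then have "observations ?A f \<epsilon> m = ?h m" "m < n J" by auto
    then show ?case using go[of m] by simp
  qed simp
  have at: "halts_at ?A f \<epsilon> (n J)"
    unfolding halts_at_def obs[OF order_refl] stop by blast
  then show "halts ?A f \<epsilon>" unfolding halts_def by blast
  then have "(LEAST m. halts_at ?A f \<epsilon> m) = n J"
  proof (intro Least_equality at)
    fix m assume m: "halts_at ?A f \<epsilon> m"
    show "n J \<le> m"
    proof (rule ccontr)
      assume "\<not> n J \<le> m"
      then show False using m go[of m] obs[of m] by (simp add: halts_at_def)
    qed
  qed
  then have final: "final_observations ?A f \<epsilon> = ?h (n J)"
    unfolding final_observations_def using obs by simp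
  show "alg_output ?A f \<epsilon> = APP k f (n J)"
    unfolding alg_output_def final stop known_part_prefix by (auto simp: APP_def)
  have "fst ` set (?h (n J)) = k ` {1..n J}"
    by (simp add: image_image atLeastLessThanSuc_atLeastAtMost del: upt_Suc)
  moreover have "inj_on k {1..n J}"
    using k by (auto simp: bij_betw_def intro: inj_on_subset)
  ultimately show "alg_cost ?A f \<epsilon> = enat (n J)"
    using \<open>halts ?A f \<epsilon>\<close> by (simp add: alg_cost_def final card_image del: upt_Suc)
qed

end

theory Submission
  imports Defs
begin

text \<open>Write \<open>K\<^sub>l\<close> for the blocks and \<open>\<Lambda>\<^sub>l\<close> for the norm of the weights on \<open>K\<^sub>l\<close>. The quantity that governs
  both the adaptive algorithm and every competitor is \<open>R * b ^ l * \<Lambda>\<^sub>l\<close>: in the cone,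
  \<open>\<sigma>\<^sub>l(f) \<le> a * b ^ (l - 1) * R\<close>, so by Hoelder's inequality no input in the ball can carry more than a
  multiple of \<open>R * b ^ l * \<Lambda>\<^sub>l\<close> of output norm on \<open>K\<^sub>l\<close>, and some inputs do carry that much there.

  Upper bound (\<open>ERR_le\<close>). The tail norm in \<open>ERR\<^sub>j\<close> is dominated by a geometric series, so \<open>ERR\<^sub>j(f)\<close> is at
  most a constant times \<open>R * b ^ j * \<Lambda>\<^sub>j\<close>. If the algorithm stops at level \<open>J = j + 1\<close>, it did not stop at
  \<open>j\<close>, and hence \<open>\<epsilon>\<close> is at most a constant times \<open>R * b ^ J * \<Lambda>\<^sub>j\<close>. For \<open>J = 1\<close> no test came before; there
  the same bound on \<open>\<epsilon>\<close> is what the choice of \<open>\<epsilon>\<^sub>m\<^sub>a\<^sub>x\<close> and \<open>R\<^sub>m\<^sub>i\<^sub>n\<close> provides.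

  Lower bound (\<open>tolerance_lower_bound\<close>). Let \<open>f\<close> be nonnegative with \<open>f / lam\<close> constant on each of the
  blocks up to level \<open>J + 1\<close>, scaled so that \<open>\<sigma>\<^sub>l(f) = (1 - b) * R * b ^ l\<close>. It decays exactly like
  \<open>b ^ r\<close>, while the cone tolerates the factor \<open>a > 1\<close>. So multiplying \<open>f\<close> by \<open>a\<close> on an arbitrary set of
  wavenumbers does not leave the cone (\<open>profile_in_decay_cone\<close>). If a competitor observes at most \<open>n J\<close>
  coefficients of \<open>f\<close>, then (c) yields a block \<open>K\<^sub>l\<close>, \<open>l \<le> J + 1\<close>, a fixed fraction of which is
  unobserved. Let \<open>g\<close> be \<open>f\<close> multiplied by \<open>a\<close> on this unobserved part. The competitor cannot tell \<open>f\<close>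
  from \<open>g\<close>, so it returns the same output for both and errs for one of them by at least half their
  distance on at least half of the unobserved part (\<open>fooling_pair_bound\<close>). By (b) the weights are comparable within \<open>K\<^sub>l\<close>, and
  \<open>1 / \<tau> = 1 / \<rho> + 1 / \<rho>'\<close> turns that distance into a multiple of \<open>R * b ^ l * \<Lambda>\<^sub>l\<close>.

  By (a), \<open>b ^ l * \<Lambda>\<^sub>l\<close> for \<open>l \<le> J + 1\<close> is at least a constant times \<open>b ^ J * \<Lambda>\<^sub>j\<close>. The competitor's
  tolerance is therefore at least a fixed multiple of \<open>\<epsilon>\<close>, and taking \<open>\<omega>\<close> half as large as that
  multiple rules out any competitor whose worst-case cost in the ball is below \<open>n J\<close>.\<close>

section \<open>Sequence norms\<close>

lemma lp_enorm_mono: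
  fixes x :: "'i \<Rightarrow> 'c::real_normed_vector" and y :: "'i \<Rightarrow> 'd::real_normed_vector"
  assumes "A \<subseteq> B" and le: "\<And>i. i \<in> A \<Longrightarrow> norm (x i) \<le> norm (y i)"
  shows "lp_enorm p A x \<le> lp_enorm p B y"
proof (cases "p = \<infinity>")
  case True
  then show ?thesis
    unfolding lp_enorm_def using assms by (auto intro!: SUP_mono ennreal_leI)
next
  case False
  define t where "t = enn2real p"
  have t: "0 \<le> t" by (simp add: t_def)
  show ?thesis
  proof (cases "(\<lambda>i. norm (y i) powr t) summable_on B")
    case ysum: True
    then have "(\<lambda>i. norm (y i) powr t) summable_on A"
      using \<open>A \<subseteq> B\<close> by (rule summable_on_subset_banach)
    then have xsum: "(\<lambda>i. norm (x i) powr t) summable_on A"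
      by (rule summable_on_comparison_test) (use t le in \<open>auto intro!: powr_mono2\<close>)
    have "(\<Sum>\<^sub>\<infinity>i\<in>A. norm (x i) powr t) \<le> (\<Sum>\<^sub>\<infinity>i\<in>B. norm (y i) powr t)"
      by (rule infsum_mono_neutral[OF xsum ysum])
        (use t le \<open>A \<subseteq> B\<close> in \<open>auto intro!: powr_mono2\<close>)
    then show ?thesis
      using False xsum ysum t
      by (auto simp: lp_enorm_def t_def[symmetric] intro!: ennreal_leI powr_mono2 infsum_nonneg)
  qed (use False in \<open>simp add: lp_enorm_def t_def\<close>)
qed

text \<open>For \<open>p = \<infinity>\<close> the exponent \<open>1 / enn2real p\<close> evaluates to \<open>0\<close>, and \<open>0 powr 0 = 0\<close> matches the norm
  of the empty family; so one formula serves all \<open>p\<close> and all finite \<open>A\<close>.\<close>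

lemma lp_enorm_const:
  fixes x :: "'i \<Rightarrow> 'c::real_normed_vector"
  assumes "finite A" "1 \<le> p" "0 \<le> c" and x: "\<And>i. i \<in> A \<Longrightarrow> norm (x i) = c"
  shows "lp_enorm p A x = ennreal (c * real (card A) powr (1 / enn2real p))"
proof (cases "p = \<infinity>")
  case True
  then show ?thesis
    using x \<open>finite A\<close> by (cases "A = {}") (simp_all add: lp_enorm_def bot_ennreal)
next
  case False
  define t where "t = enn2real p"
  have t: "0 < t"
    using False \<open>1 \<le> p\<close> by (auto simp: t_def enn2real_positive_iff less_top[symmetric] intro: less_le_trans[of 0 1])
  have "(\<Sum>i\<in>A. norm (x i) powr t) = real (card A) * c powr t"
    using x by simp
  then show ?thesis
    using False t \<open>finite A\<close> \<open>0 \<le> c\<close>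
    by (simp add: lp_enorm_def t_def[symmetric] powr_mult powr_powr)
qed

lemma lp_enorm_le_const:
  fixes x :: "'i \<Rightarrow> 'c::real_normed_vector"
  assumes "finite A" "1 \<le> p" "0 \<le> c" and x: "\<And>i. i \<in> A \<Longrightarrow> norm (x i) \<le> c"
  shows "lp_enorm p A x \<le> ennreal (c * real (card A) powr (1 / enn2real p))"
  using lp_enorm_mono[OF order_refl, of A x "\<lambda>_. c" p] lp_enorm_const[of A p c "\<lambda>_. c"] assms
  by simp

lemma lp_enorm_ge_const:
  fixes x :: "'i \<Rightarrow> 'c::real_normed_vector"
  assumes "finite M" "M \<subseteq> A" "1 \<le> p" "0 \<le> c" and x: "\<And>i. i \<in> M \<Longrightarrow> c \<le> norm (x i)"
  shows "ennreal (c * real (card M) powr (1 / enn2real p)) \<le> lp_enorm p A x"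
  using lp_enorm_mono[of M A "\<lambda>_. c" x p] lp_enorm_const[of M p c "\<lambda>_. c"] assms
  by simp

lemma lp_enorm_finite:
  assumes "finite A" "1 \<le> p"
  shows "lp_enorm p A x < \<infinity>"
proof -
  have "\<exists>c\<ge>0. \<forall>i\<in>A. norm (x i) \<le> c"
    using \<open>finite A\<close> by (intro exI[of _ "\<Sum>i\<in>A. norm (x i)"]) (auto intro: member_le_sum sum_nonneg)
  then obtain c where "0 \<le> c" "\<And>i. i \<in> A \<Longrightarrow> norm (x i) \<le> c"
    by blast
  then have "lp_enorm p A x \<le> ennreal (c * real (card A) powr (1 / enn2real p))"
    using assms by (intro lp_enorm_le_const)
  also have "\<dots> < \<infinity>"
    unfolding infinity_ennreal_def by (rule ennreal_less_top)
  finally show ?thesis .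
qed

text \<open>For \<open>p \<ge> 1\<close> the \<open>p\<close>-th powers decay with ratio \<open>q powr p \<le> q\<close>, and the root of \<open>1 / (1 - q) \<ge> 1\<close>
  only makes it smaller.\<close>

lemma lp_enorm_geometric:
  fixes c q :: real
  assumes "1 \<le> p" "0 < q" "q < 1" "0 \<le> c"
  shows "lp_enorm p A (\<lambda>r. c * q ^ r) \<le> ennreal (c / (1 - q))"
proof -
  have "lp_enorm p A (\<lambda>r. c * q ^ r) \<le> lp_enorm p UNIV (\<lambda>r. c * q ^ r)"
    by (rule lp_enorm_mono) auto
  also have "\<dots> \<le> ennreal (c / (1 - q))"
  proof (cases "p = \<infinity>")
    case True
    have "c * q ^ r \<le> c / (1 - q)" for r
    proof -
      have "q ^ r \<le> 1" using assms by (simp add: power_le_one)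
      also have "\<dots> \<le> 1 / (1 - q)" using assms by simp
      finally show ?thesis using assms(4) mult_left_mono by fastforce
    qed
    then show ?thesis using True assms
      by (auto simp: lp_enorm_def intro!: SUP_least ennreal_leI)
  next
    case False
    define t where "t = enn2real p"
    have t: "1 \<le> t"
      using False \<open>1 \<le> p\<close> enn2real_mono[of 1 p] by (simp add: t_def less_top)
    have qt: "0 < q powr t" "q powr t \<le> q"
      using assms t powr_le_one_le[of q t] by auto
    have power_term: "norm (c * q ^ r) powr t = c powr t * (q powr t) ^ r" for r
      using assms by (simp add: powr_mult powr_realpow[symmetric] powr_powr mult.commute)
    have "(\<lambda>r. (q powr t) ^ r) sums (1 / (1 - q powr t))"
      using qt assms by (intro geometric_sums) auto
    then have "(\<lambda>r. c powr t * (q powr t) ^ r) sums (c powr t * (1 / (1 - q powr t)))"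
      by (rule sums_mult)
    then have hs: "((\<lambda>r. norm (c * q ^ r) powr t) has_sum (c powr t * (1 / (1 - q powr t)))) UNIV"
      unfolding power_term by (rule sums_nonneg_imp_has_sum) (use assms qt in auto)
    have "(c powr t * (1 / (1 - q powr t))) powr (1/t) = c * (1 / (1 - q powr t)) powr (1/t)"
      using t assms qt by (subst powr_mult) (auto simp: powr_powr)
    also have "\<dots> \<le> c * (1 / (1 - q)) powr (1/t)"
      using assms qt t by (intro mult_left_mono powr_mono2) (auto intro!: divide_left_mono)
    also have "\<dots> \<le> c * (1 / (1 - q)) powr 1"
      using assms t by (intro mult_left_mono powr_mono) auto
    finally show ?thesis
      using False infsumI[OF hs] has_sum_imp_summable[OF hs] assms
      by (auto simp: lp_enorm_def t_def[symmetric] intro!: ennreal_leI)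
  qed
  finally show ?thesis .
qed

section \<open>Inputs that an algorithm cannot distinguish\<close>

lemma observations_subset:
  "m \<le> m' \<Longrightarrow> set (observations A f \<epsilon> m) \<subseteq> set (observations A f \<epsilon> m')"
  by (rule lift_Suc_mono_le[of "\<lambda>m. set (observations A f \<epsilon> m)"]) (auto split: sum.split)

text \<open>A deterministic algorithm reacts only to what it has seen, so its runs on \<open>f\<close> and \<open>g\<close> stay
  identical as long as all queried coefficients agree.\<close>

lemma alg_output_eqI:
  assumes halts: "halts A f \<epsilon>"
    and agree: "\<And>x. x \<in> fst ` set (final_observations A f \<epsilon>) \<Longrightarrow> f x = g x"
  shows "alg_output A g \<epsilon> = alg_output A f \<epsilon>"
proof -
  define m where "m = (LEAST m. halts_at A f \<epsilon> m)"
  have m: "halts_at A f \<epsilon> m"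
    using halts unfolding halts_def m_def by (rule LeastI_ex)
  have same: "observations A g \<epsilon> i = observations A f \<epsilon> i" if "i \<le> m" for i
    using that
  proof (induction i)
    case (Suc i)
    show ?case
    proof (cases "A \<epsilon> (observations A f \<epsilon> i)")
      case (Inl x)
      then have "(x, f x) \<in> set (observations A f \<epsilon> (Suc i))" by simp
      then have "(x, f x) \<in> set (observations A f \<epsilon> m)"
        using observations_subset[OF Suc.prems] by blast
      then have "f x = g x"
        by (intro agree) (force simp: final_observations_def m_def)
      then show ?thesis using Suc Inl by simp
    qed (use Suc in simp)
  qed simp
  have "(LEAST i. halts_at A g \<epsilon> i) = m"
  proof (rule Least_equality)
    show "halts_at A g \<epsilon> m" using m same by (simp add: halts_at_def)
    show "m \<le> i" if "halts_at A g \<epsilon> i" for i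
      using that same[of i] Least_le[of "halts_at A f \<epsilon>" i]
      by (cases "i \<le> m") (auto simp: halts_at_def m_def)
  qed
  then show ?thesis
    using same by (simp add: alg_output_def final_observations_def m_def)
qed

text \<open>The common output is at distance at least \<open>c\<close> from \<open>f\<close> or from \<open>g\<close> at each point of \<open>M\<close>, and one
  of the two cases covers at least half of \<open>M\<close>.\<close>

lemma fooling_pair_bound:
  fixes f g :: "'k \<Rightarrow> 'c::real_normed_vector"
  assumes "1 \<le> \<tau>" "0 < \<epsilon>" and A: "A \<in> admissible \<tau> C" and fg: "f \<in> C" "g \<in> C"
    and agree: "\<And>x. x \<in> fst ` set (final_observations A f \<epsilon>) \<Longrightarrow> f x = g x"
    and "finite M" "0 \<le> c" and apart: "\<And>x. x \<in> M \<Longrightarrow> 2 * c \<le> norm (f x - g x)"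
  shows "c * (real (card M) / 2) powr (1 / enn2real \<tau>) \<le> \<epsilon>"
proof -
  define out where "out = alg_output A f \<epsilon>"
  have out: "alg_output A g \<epsilon> = out"
    unfolding out_def using A fg \<open>0 < \<epsilon>\<close> agree
    by (intro alg_output_eqI) (auto simp: admissible_def)
  have one: "c * (real (card M) / 2) powr (1 / enn2real \<tau>) \<le> \<epsilon>"
    if "h \<in> C" "alg_output A h \<epsilon> = out" "N \<subseteq> M" "card M \<le> 2 * card N"
      "\<And>x. x \<in> N \<Longrightarrow> c \<le> norm (h x - out x)" for h N
  proof -
    have "ennreal (c * real (card N) powr (1 / enn2real \<tau>)) \<le> output_norm \<tau> (\<lambda>x. SOL h x - out x)"
      unfolding output_norm_def SOL_def
      using that assms by (intro lp_enorm_ge_const) (auto intro: finite_subset)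
    also have "\<dots> \<le> ennreal \<epsilon>"
      using A that \<open>0 < \<epsilon>\<close> by (auto simp: admissible_def)
    finally have "c * real (card N) powr (1 / enn2real \<tau>) \<le> \<epsilon>"
      using \<open>0 < \<epsilon>\<close> by simp
    moreover have "(real (card M) / 2) powr (1 / enn2real \<tau>) \<le> real (card N) powr (1 / enn2real \<tau>)"
      using that by (intro powr_mono2) auto
    ultimately show ?thesis
      using mult_left_mono[OF _ \<open>0 \<le> c\<close>] by (meson order_trans)
  qed
  define N where "N = {x \<in> M. c \<le> norm (f x - out x)}"
  have N': "c \<le> norm (g x - out x)" if "x \<in> M - N" for x
    using that apart[of x] norm_triangle_ineq4[of "f x - out x" "g x - out x"]
    by (auto simp: N_def)
  have "card M = card N + card (M - N)"
    using \<open>finite M\<close> by (subst card_Diff_subset) (auto simp: N_def card_mono)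
  then consider "card M \<le> 2 * card N" | "card M \<le> 2 * card (M - N)" by linarith
  then show ?thesis
  proof cases
    case 1
    then show ?thesis by (intro one[of f N]) (use fg in \<open>auto simp: N_def out_def\<close>)
  next
    case 2
    then show ?thesis by (intro one[of g "M - N"]) (use fg out N' in auto)
  qed
qed


lemma lp_norm_le_const:
  fixes x :: "'i \<Rightarrow> 'c::real_normed_vector"
  assumes "finite A" "1 \<le> p" "0 \<le> c" "\<And>i. i \<in> A \<Longrightarrow> norm (x i) \<le> c"
  shows "lp_norm p A x \<le> c * real (card A) powr (1 / enn2real p)"
  using enn2real_mono[OF lp_enorm_le_const[OF assms]] \<open>0 \<le> c\<close>
  by (simp add: lp_norm_def)

lemma lp_norm_ge_const:
  fixes x :: "'i \<Rightarrow> 'c::real_normed_vector"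
  assumes "finite A" "M \<subseteq> A" "1 \<le> p" "0 \<le> c" "\<And>i. i \<in> M \<Longrightarrow> c \<le> norm (x i)"
  shows "c * real (card M) powr (1 / enn2real p) \<le> lp_norm p A x"
  using enn2real_mono[OF lp_enorm_ge_const[of M A p c x]] assms finite_subset[of M A]
    lp_enorm_finite[of A p x]
  by (simp add: lp_norm_def)

lemma lp_norm_nonneg: "0 \<le> lp_norm p A x"
  by (simp add: lp_norm_def)

text \<open>An entry bounded by \<open>c l / card (B l) powr (1 / p)\<close> throughout \<open>B l\<close> contributes at most \<open>c l\<close> in
  norm from that block, and the \<open>\<ell>\<^sup>p\<close> norm of a family is the \<open>\<ell>\<^sup>p\<close> norm of its block norms.\<close>

lemma lp_enorm_blockwise_le:
  fixes x :: "'i \<Rightarrow> 'c::real_normed_vector" and c :: "'j \<Rightarrow> real"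
  assumes "1 \<le> p" "finite I" and B: "\<And>l. l \<in> I \<Longrightarrow> finite (B l)" "\<And>l. l \<in> I \<Longrightarrow> B l \<noteq> {}"
    and disj: "\<And>l l'. l \<in> I \<Longrightarrow> l' \<in> I \<Longrightarrow> l \<noteq> l' \<Longrightarrow> B l \<inter> B l' = {}"
    and c: "\<And>l. l \<in> I \<Longrightarrow> 0 \<le> c l"
    and le: "\<And>l i. l \<in> I \<Longrightarrow> i \<in> B l \<Longrightarrow> norm (x i) \<le> c l / real (card (B l)) powr (1 / enn2real p)"
    and off: "\<And>i. i \<notin> (\<Union>l\<in>I. B l) \<Longrightarrow> x i = 0"
  shows "lp_enorm p UNIV x \<le> lp_enorm p I c"
proof (cases "p = \<infinity>")
  case True
  have "ennreal (norm (x i)) \<le> (SUP l\<in>I. ennreal (norm (c l)))" for i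
  proof (cases "i \<in> (\<Union>l\<in>I. B l)")
    case True
    then obtain l where l: "l \<in> I" "i \<in> B l" by blast
    then have "card (B l) \<noteq> 0" using B by auto
    then have "norm (x i) \<le> norm (c l)"
      using le[OF l] c[OF l(1)] \<open>p = \<infinity>\<close> by simp
    then show ?thesis using l(1) by (intro SUP_upper2[of l]) (auto intro: ennreal_leI)
  qed (simp add: off)
  then show ?thesis
    using True by (simp add: lp_enorm_def SUP_least)
next
  case False
  define t where "t = enn2real p"
  have t: "0 < t"
    using False \<open>1 \<le> p\<close> by (auto simp: t_def enn2real_positive_iff less_top[symmetric] intro: less_le_trans[of 0 1])
  let ?U = "\<Union>l\<in>I. B l"
  have fin: "finite ?U" using B \<open>finite I\<close> by blast
  have sm: "(\<lambda>i. norm (x i) powr t) summable_on UNIV"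
    using fin by (subst summable_on_cong_neutral[of ?U UNIV _ "\<lambda>i. norm (x i) powr t"]) (auto simp: off)
  have "(\<Sum>\<^sub>\<infinity>i. norm (x i) powr t) = (\<Sum>\<^sub>\<infinity>i\<in>?U. norm (x i) powr t)"
    by (intro infsum_cong_neutral) (auto simp: off)
  also have "\<dots> = (\<Sum>i\<in>?U. norm (x i) powr t)" using fin by simp
  also have "\<dots> = (\<Sum>l\<in>I. \<Sum>i\<in>B l. norm (x i) powr t)"
    using \<open>finite I\<close> B disj by (intro sum.UNION_disjoint) auto
  also have "\<dots> \<le> (\<Sum>l\<in>I. \<Sum>i\<in>B l. (c l) powr t / real (card (B l)))"
  proof (intro sum_mono)
    fix l i assume l: "l \<in> I" "i \<in> B l"
    then have "0 < card (B l)" using B by (auto simp: card_gt_0_iff)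
    have "norm (x i) powr t \<le> (c l / real (card (B l)) powr (1 / t)) powr t"
      using le[OF l] t by (intro powr_mono2) (auto simp: t_def)
    also have "\<dots> = c l powr t / real (card (B l))"
      using t c[OF l(1)] by (simp add: powr_divide powr_powr)
    finally show "norm (x i) powr t \<le> c l powr t / real (card (B l))" .
  qed
  also have "\<dots> = (\<Sum>l\<in>I. norm (c l) powr t)"
    using B c by (intro sum.cong) auto
  finally have "(\<Sum>\<^sub>\<infinity>i. norm (x i) powr t) \<le> (\<Sum>l\<in>I. norm (c l) powr t)" .
  then show ?thesis
    using False sm t \<open>finite I\<close>
    by (auto simp: lp_enorm_def t_def[symmetric] intro!: ennreal_leI powr_mono2 infsum_nonneg)
qed

text \<open>Since \<open>enn2real \<infinity> = 0\<close> and division by \<open>0\<close> yields \<open>0\<close>, the real equation also covers infinite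
  exponents.\<close>

lemma conjugate_exponents:
  fixes \<tau> \<rho> \<rho>' :: ennreal
  assumes "1 \<le> \<tau>" "\<tau> \<le> \<rho>" "1 / \<rho> + 1 / \<rho>' = 1 / \<tau>"
  shows "1 \<le> \<rho>'" "1 / enn2real \<rho> + 1 / enn2real \<rho>' = 1 / enn2real \<tau>"
proof -
  have recip: "1 / x = ennreal (1 / enn2real x)" if "1 \<le> x" for x :: ennreal
  proof (cases x)
    case (real r)
    then have "1 \<le> r" using that by simp
    then show ?thesis using real divide_ennreal[of 1 r] by simp
  qed simp
  have "1 / \<rho>' \<le> 1 / \<tau>"
    unfolding assms(3)[symmetric] by simp
  also have "\<dots> \<le> 1"
    using \<open>1 \<le> \<tau>\<close> by (cases \<tau>) (auto simp: recip)
  finally have le: "1 / \<rho>' \<le> 1" .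
  show 1: "1 \<le> \<rho>'"
  proof (cases \<rho>')
    case (real r)
    have "0 < r"
      using le real by (cases "r = 0") (auto simp: ennreal_divide_zero top_unique)
    then show ?thesis using le real divide_ennreal[of 1 r]
      by (auto simp: divide_le_eq)
  qed simp
  have "1 \<le> \<rho>" using assms by simp
  have "ennreal (1 / enn2real \<rho> + 1 / enn2real \<rho>') = ennreal (1 / enn2real \<tau>)"
    using assms(3) recip[OF 1] recip[OF \<open>1 \<le> \<rho>\<close>] recip[OF \<open>1 \<le> \<tau>\<close>]
    by (simp add: ennreal_plus)
  then show "1 / enn2real \<rho> + 1 / enn2real \<rho>' = 1 / enn2real \<tau>"
    by (subst (asm) ennreal_inj) auto
qed

section \<open>Blocks and level profiles\<close>

locale enumerated_blocks =
  fixes k :: "nat \<Rightarrow> 'k" and n :: "nat \<Rightarrow> nat"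
  assumes bij: "bij_betw k {1..} UNIV" and strict_mono: "strict_mono n"
begin

abbreviation K :: "nat \<Rightarrow> 'k set" where "K \<equiv> block k n"

lemma finite_block: "finite (K j)"
  by (simp add: block_def)

lemma block_nonempty:
  assumes "0 < n 0 \<or> 0 < j" shows "K j \<noteq> {}"
proof -
  have "(if j = 0 then 0 else n (j - 1)) < n j"
    using assms strict_monoD[OF strict_mono, of "j - 1" j] by auto
  then show ?thesis by (auto simp: block_def)
qed

lemma block_disjoint:
  assumes "i \<noteq> j" shows "K i \<inter> K j = {}"
proof -
  have *: "K i \<inter> K j = {}" if "i < j" for i j
  proof -
    have "n i \<le> n (j - 1)"
      using that strict_mono by (simp add: strict_mono_less_eq)
    then have "{(if i = 0 then 0 else n (i - 1)) + 1..n i} \<inter> {n (j - 1) + 1..n j} = {}"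
      by auto
    moreover have "inj_on k {1..}" using bij by (auto simp: bij_betw_def)
    ultimately show ?thesis
      using that unfolding block_def
      by (subst inj_on_image_Int[of k "{1..}", symmetric]) auto
  qed
  show ?thesis using *[of i j] *[of j i] assms by (metis Int_commute linorder_neqE_nat)
qed

text \<open>On \<open>K l\<close>, \<open>l \<le> L\<close>, the quotient \<open>profile / lam\<close> is the constant whose \<open>\<ell>\<^sup>\<rho>\<close> norm over the block is
  \<open>s * b ^ l\<close>; elsewhere it is \<open>0\<close>. As the blocks are disjoint, the sum has at most one nonzero term.\<close>

definition profile :: "ennreal \<Rightarrow> ('k \<Rightarrow> real) \<Rightarrow> real \<Rightarrow> real \<Rightarrow> nat \<Rightarrow> 'k \<Rightarrow> real" where
  "profile \<rho> lam s b L x =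
    lam x * (\<Sum>l\<le>L. if x \<in> K l then s * b ^ l / real (card (K l)) powr (1 / enn2real \<rho>) else 0)"

lemma profile_on_block:
  assumes "x \<in> K l"
  shows "profile \<rho> lam s b L x =
    (if l \<le> L then lam x * (s * b ^ l / real (card (K l)) powr (1 / enn2real \<rho>)) else 0)"
proof -
  have "x \<in> K i \<longleftrightarrow> i = l" for i using assms block_disjoint[of i l] by auto
  then show ?thesis by (simp add: profile_def)
qed

lemma profile_off_blocks: "x \<notin> (\<Union>l\<le>L. K l) \<Longrightarrow> profile \<rho> lam s b L x = 0"
  by (auto simp: profile_def intro!: sum.neutral)

lemma profile_nonneg: "0 \<le> s \<Longrightarrow> 0 \<le> b \<Longrightarrow> 0 \<le> lam x \<Longrightarrow> 0 \<le> profile \<rho> lam s b L x"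
  by (auto simp: profile_def intro!: mult_nonneg_nonneg sum_nonneg)

lemma norm_profile_coefficient:
  assumes "0 \<le> s" "0 \<le> b" "0 < lam x" "0 \<le> c"
  shows "norm (of_real (c * profile \<rho> lam s b L x) /\<^sub>R lam x :: 'c::real_normed_field)
    = c * (profile \<rho> lam s b L x / lam x)"
proof -
  have "0 \<le> profile \<rho> lam s b L x" using assms by (intro profile_nonneg) auto
  then show ?thesis
    using assms by (simp only: norm_scaleR norm_of_real) (simp add: field_simps abs_mult)
qed

lemma input_norm_profile_le:
  assumes "0 < n 0" "1 \<le> \<rho>" "0 < b" "b < 1" "0 \<le> s" and lam: "\<And>x. 0 < lam x"
    and \<mu>: "\<And>x. 0 \<le> \<mu> x" "\<And>x. \<mu> x \<le> m"
  shows "input_norm \<rho> lam (\<lambda>x. of_real (\<mu> x * profile \<rho> lam s b L x) :: 'c::real_normed_field)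
    \<le> ennreal (m * s / (1 - b))"
proof -
  have "0 \<le> m" using \<mu> order_trans by blast
  have "input_norm \<rho> lam (\<lambda>x. of_real (\<mu> x * profile \<rho> lam s b L x) :: 'c)
      \<le> lp_enorm \<rho> {..L} (\<lambda>l. (m * s) * b ^ l)"
    unfolding input_norm_def
  proof (rule lp_enorm_blockwise_le[where B = K])
    fix l x assume l: "l \<in> {..L}" "x \<in> K l"
    have p: "profile \<rho> lam s b L x / lam x = s * b ^ l / real (card (K l)) powr (1 / enn2real \<rho>)"
      using l lam[of x] by (simp add: profile_on_block)
    have "norm (of_real (\<mu> x * profile \<rho> lam s b L x) /\<^sub>R lam x :: 'c)
        = \<mu> x * (profile \<rho> lam s b L x / lam x)"
      using \<mu>(1)[of x] assms by (intro norm_profile_coefficient) auto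
    also have "\<dots> \<le> m * (s * b ^ l / real (card (K l)) powr (1 / enn2real \<rho>))"
      unfolding p using \<mu>(2)[of x] assms by (intro mult_right_mono) auto
    finally show "norm (of_real (\<mu> x * profile \<rho> lam s b L x) /\<^sub>R lam x :: 'c)
        \<le> m * s * b ^ l / real (card (K l)) powr (1 / enn2real \<rho>)"
      by simp
  qed (use assms \<open>0 \<le> m\<close> finite_block block_nonempty block_disjoint in \<open>auto simp: profile_off_blocks\<close>)
  also have "\<dots> \<le> ennreal (m * s / (1 - b))"
    using assms \<open>0 \<le> m\<close> by (intro lp_enorm_geometric) auto
  finally show ?thesis .
qed

text \<open>Modulation by \<open>\<mu>\<close> between \<open>1\<close> and \<open>a\<close> keeps the block norm of level \<open>l \<le> L\<close> between \<open>s * b ^ l\<close> and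
  \<open>a * s * b ^ l\<close>. Hence a later block exceeds the decay \<open>b ^ r\<close> relative to an earlier one by at most
  the factor \<open>a\<close> allowed in the cone, whatever \<open>\<mu>\<close> does within the blocks.\<close>

lemma profile_in_decay_cone:
  assumes "0 < n 0" "1 \<le> \<rho>" "0 < b" "b < 1" "0 \<le> s" "1 \<le> a" and lam: "\<And>x. 0 < lam x"
    and \<mu>: "\<And>x. 1 \<le> \<mu> x" "\<And>x. \<mu> x \<le> a"
  shows "(\<lambda>x. of_real (\<mu> x * profile \<rho> lam s b L x) :: 'c::real_normed_field) \<in> decay_cone a b \<rho> lam k n"
proof -
  define f :: "'k \<Rightarrow> 'c" where "f = (\<lambda>x. of_real (\<mu> x * profile \<rho> lam s b L x))"
  have \<mu>0: "0 \<le> \<mu> x" for x using \<mu>(1)[of x] by linarith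
  have "input_norm \<rho> lam f < \<infinity>"
    using \<mu>0 assms unfolding f_def by (intro le_less_trans[OF input_norm_profile_le]) auto
  have size: "norm (f x /\<^sub>R lam x) = \<mu> x * (profile \<rho> lam s b L x / lam x)" for x
    unfolding f_def using \<mu>0[of x] assms by (intro norm_profile_coefficient) auto
  have on: "profile \<rho> lam s b L x / lam x = s * b ^ l / real (card (K l)) powr (1 / enn2real \<rho>)"
    if "x \<in> K l" "l \<le> L" for x l
    using that lam[of x] by (simp add: profile_on_block)
  have card: "0 < real (card (K l))" for l
    using finite_block block_nonempty[of l] \<open>0 < n 0\<close> by (auto simp: card_gt_0_iff)
  have upper: "sigma \<rho> lam k n l f \<le> a * s * b ^ l" if "l \<le> L" for l
  proof -
    have "sigma \<rho> lam k n l f \<le>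
        (a * (s * b ^ l / real (card (K l)) powr (1 / enn2real \<rho>))) * real (card (K l)) powr (1 / enn2real \<rho>)"
      unfolding sigma_def
    proof (rule lp_norm_le_const)
      fix x assume "x \<in> K l"
      then show "norm (f x /\<^sub>R lam x) \<le> a * (s * b ^ l / real (card (K l)) powr (1 / enn2real \<rho>))"
        unfolding size using \<mu>(2)[of x] that assms by (simp only: on) (intro mult_right_mono, auto)
    qed (use finite_block assms in auto)
    also have "\<dots> = a * s * b ^ l" using card[of l] by simp
    finally show ?thesis .
  qed
  have lower: "s * b ^ l \<le> sigma \<rho> lam k n l f" if "l \<le> L" for l
  proof -
    have "s * b ^ l = (s * b ^ l / real (card (K l)) powr (1 / enn2real \<rho>)) * real (card (K l)) powr (1 / enn2real \<rho>)"
      using card[of l] by simp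
    also have "\<dots> \<le> sigma \<rho> lam k n l f"
      unfolding sigma_def
    proof (rule lp_norm_ge_const)
      fix x assume "x \<in> K l"
      then have "norm (f x /\<^sub>R lam x) = \<mu> x * (s * b ^ l / real (card (K l)) powr (1 / enn2real \<rho>))"
        using that by (simp only: size on)
      then show "s * b ^ l / real (card (K l)) powr (1 / enn2real \<rho>) \<le> norm (f x /\<^sub>R lam x)"
        using mult_right_mono[OF \<mu>(1)[of x], of "s * b ^ l / real (card (K l)) powr (1 / enn2real \<rho>)"] assms
        by simp
    qed (use finite_block assms in auto)
    finally show ?thesis .
  qed
  have beyond: "sigma \<rho> lam k n l f \<le> 0" if "L < l" for l
    using lp_norm_le_const[OF finite_block \<open>1 \<le> \<rho>\<close> order_refl, of l "\<lambda>x. f x /\<^sub>R lam x"] that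
    by (simp add: sigma_def f_def profile_on_block)
  have "sigma \<rho> lam k n (j + r) f \<le> a * b ^ r * sigma \<rho> lam k n j f" for j r
  proof (cases "j + r \<le> L")
    case True
    have "sigma \<rho> lam k n (j + r) f \<le> a * b ^ r * (s * b ^ j)"
      using upper[OF True] by (simp add: power_add mult_ac)
    also have "\<dots> \<le> a * b ^ r * sigma \<rho> lam k n j f"
      using lower[of j] True assms by (intro mult_left_mono) auto
    finally show ?thesis .
  next
    case False
    then have "sigma \<rho> lam k n (j + r) f \<le> 0" by (intro beyond) simp
    also have "0 \<le> a * b ^ r * sigma \<rho> lam k n j f"
      using assms by (simp add: sigma_def lp_norm_nonneg)
    finally show ?thesis .
  qed
  then show ?thesis
    using \<open>input_norm \<rho> lam f < \<infinity>\<close> unfolding decay_cone_def input_space_def f_def by blast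
qed


lemma Lam_pos:
  assumes "1 \<le> \<rho>'" "0 < n 0 \<or> 0 < j" and lam: "\<And>x. 0 < lam x"
  shows "0 < Lam \<rho>' lam k n j"
proof -
  obtain x where "x \<in> K j" using block_nonempty[OF assms(2)] by blast
  then have "lam x * real (card {x}) powr (1 / enn2real \<rho>') \<le> Lam \<rho>' lam k n j"
    unfolding Lam_def using finite_block assms(1) lam[of x]
    by (intro lp_norm_ge_const) auto
  then show ?thesis using lam[of x] by simp
qed

section \<open>The lower bound for arbitrary algorithms\<close>

text \<open>The fooling pair consists of the plain profile \<open>f\<close> and of \<open>g\<close>, which is \<open>a\<close> times as large on the
  unobserved part \<open>M\<close> of a block. The cost is measured on \<open>f\<close>, which lies in the ball, while \<open>g\<close>
  enters through the correctness of the algorithm on the whole cone. Inside the block, \<open>f\<close> is at least \<open>s * b ^ l * \<Lambda> / S * N powr - (1 / \<tau>)\<close>, where \<open>N\<close> is the size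
  of the block, and \<open>M\<close> has at least \<open>\<theta> * N\<close> elements, so that \<open>N\<close> cancels in the bound.\<close>

lemma tolerance_lower_bound:
  fixes A :: "('k, 'c::real_normed_field) algorithm"
  assumes n0: "0 < n 0" and lam: "\<And>x. 0 < lam x"
    and exponents: "1 \<le> \<tau>" "1 \<le> \<rho>" "1 \<le> \<rho>'" "1 / enn2real \<rho> + 1 / enn2real \<rho>' = 1 / enn2real \<tau>"
    and ab: "1 < a" "0 < b" "b < 1" and "0 \<le> R" "0 < \<eta>"
    and S: "0 < S" "\<And>l x y. l \<le> L \<Longrightarrow> x \<in> K l \<Longrightarrow> y \<in> K l \<Longrightarrow> lam x \<le> S * lam y"
    and "0 < \<theta>" and missed: "\<And>J. finite J \<Longrightarrow> card J \<le> m \<Longrightarrow>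
      \<exists>l\<le>L. \<theta> * real (card (K l)) \<le> real (card (K l - J))"
    and A: "A \<in> admissible \<tau> (decay_cone a b \<rho> lam k n)"
    and cheap: "COST \<rho> lam A (decay_cone a b \<rho> lam k n) \<eta> R \<le> enat m"
  shows "\<exists>l\<le>L. (a - 1) * (1 - b) * \<theta> / (4 * S) * (R * b ^ l * Lam \<rho>' lam k n l) \<le> \<eta>"
proof -
  \<comment> \<open>The factor \<open>1 - b\<close> makes up for the geometric series over the levels, which puts \<open>f\<close> into the
    ball of radius \<open>R\<close>.\<close>
  define s where "s = (1 - b) * R"
  have s: "0 \<le> s" using assms by (simp add: s_def)
  define P where "P = profile \<rho> lam s b L"
  define f :: "'k \<Rightarrow> 'c" where "f = (\<lambda>x. of_real (1 * P x))"
  define J where "J = fst ` set (final_observations A f \<eta>)"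
  have f_cone: "f \<in> decay_cone a b \<rho> lam k n"
    unfolding f_def P_def by (rule profile_in_decay_cone) (use assms s in auto)
  have "input_norm \<rho> lam f \<le> ennreal (1 * s / (1 - b))"
    unfolding f_def P_def by (rule input_norm_profile_le) (use assms s in auto)
  also have "1 * s / (1 - b) = R" using ab by (simp add: s_def)
  finally have "f \<in> input_ball \<rho> lam R"
    using f_cone by (simp add: input_ball_def decay_cone_def)
  with f_cone have "alg_cost A f \<eta> \<le> COST \<rho> lam A (decay_cone a b \<rho> lam k n) \<eta> R"
    unfolding COST_def by (intro SUP_upper) auto
  moreover have "halts A f \<eta>" using A f_cone \<open>0 < \<eta>\<close> by (auto simp: admissible_def)
  ultimately have "card J \<le> m"
    using cheap by (simp add: alg_cost_def J_def) (metis enat_ord_simps(1) order_trans)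
  then obtain l where l: "l \<le> L" "\<theta> * real (card (K l)) \<le> real (card (K l - J))"
    using missed[of J] by (auto simp: J_def)
  define M where "M = K l - J"
  define N where "N = real (card (K l))"
  have N: "0 < N" using finite_block block_nonempty[of l] n0 by (auto simp: N_def card_gt_0_iff)
  have "finite M" "M \<subseteq> K l" by (auto simp: M_def finite_block)
  define g :: "'k \<Rightarrow> 'c" where "g = (\<lambda>x. of_real ((if x \<in> M then a else 1) * P x))"
  have g_cone: "g \<in> decay_cone a b \<rho> lam k n"
    unfolding g_def P_def by (rule profile_in_decay_cone) (use assms s in auto)
  define \<Lambda> where "\<Lambda> = Lam \<rho>' lam k n l"
  define c where "c = (a - 1) / 2 * (s * b ^ l * \<Lambda> / S * N powr - (1 / enn2real \<tau>))"
  have \<Lambda>: "0 \<le> \<Lambda>" by (simp add: \<Lambda>_def Lam_def lp_norm_nonneg)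
  have "0 \<le> c" using assms s \<Lambda> by (simp add: c_def)
  have P_ge: "s * b ^ l * \<Lambda> / S * N powr - (1 / enn2real \<tau>) \<le> P x" if "x \<in> K l" for x
  proof -
    have "\<Lambda> \<le> (S * lam x) * N powr (1 / enn2real \<rho>')"
      unfolding \<Lambda>_def Lam_def N_def
      using S l(1) that lam finite_block exponents
      by (intro lp_norm_le_const) (auto simp: less_imp_le abs_of_pos)
    then have "\<Lambda> / S * N powr - (1 / enn2real \<rho>') \<le> lam x"
      using N S by (simp add: powr_minus field_simps)
    then have "(\<Lambda> / S * N powr - (1 / enn2real \<rho>')) * (s * b ^ l * N powr - (1 / enn2real \<rho>))
        \<le> lam x * (s * b ^ l * N powr - (1 / enn2real \<rho>))"
      using s ab by (intro mult_right_mono) auto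
    also have "\<dots> = P x"
      using that l(1) by (simp add: P_def profile_on_block N_def powr_minus divide_inverse)
    also have "(\<Lambda> / S * N powr - (1 / enn2real \<rho>')) * (s * b ^ l * N powr - (1 / enn2real \<rho>))
        = s * b ^ l * \<Lambda> / S * N powr - (1 / enn2real \<tau>)"
      unfolding exponents(4)[symmetric] by (simp add: powr_add[of N "- (1 / enn2real \<rho>)" "- (1 / enn2real \<rho>')", simplified])
    finally show ?thesis .
  qed
  have "c * (real (card M) / 2) powr (1 / enn2real \<tau>) \<le> \<eta>"
  proof (rule fooling_pair_bound[OF exponents(1) \<open>0 < \<eta>\<close> A f_cone g_cone])
    show "f x = g x" if "x \<in> fst ` set (final_observations A f \<eta>)" for x
      using that by (simp add: f_def g_def M_def J_def)
    show "2 * c \<le> norm (f x - g x)" if "x \<in> M" for x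
    proof -
      have "norm (f x - g x) = \<bar>1 * P x - a * P x\<bar>"
        unfolding f_def g_def using that by (simp only: of_real_diff[symmetric] norm_of_real if_True)
      also have "\<dots> = \<bar>1 - a\<bar> * \<bar>P x\<bar>"
        by (simp only: left_diff_distrib[symmetric] abs_mult)
      also have "\<dots> = (a - 1) * P x"
        using ab profile_nonneg[of s b lam x \<rho> L] s less_imp_le[OF lam[of x]] by (simp add: P_def)
      finally show ?thesis
        using mult_left_mono[OF P_ge[of x], of "a - 1"] that \<open>M \<subseteq> K l\<close> ab by (auto simp: c_def)
    qed
  qed (use \<open>finite M\<close> \<open>0 \<le> c\<close> in auto)
  moreover have "c * (\<theta> / 2 * N powr (1 / enn2real \<tau>)) \<le> c * (real (card M) / 2) powr (1 / enn2real \<tau>)"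
  proof (intro mult_left_mono \<open>0 \<le> c\<close>)
    have "real (card M) \<le> N"
      using finite_block \<open>M \<subseteq> K l\<close> by (auto simp: N_def card_mono)
    then have "\<theta> * N \<le> 1 * N" using l(2) by (simp add: N_def M_def)
    then have "\<theta> \<le> 1" using N by simp
    have "0 \<le> 1 / enn2real \<tau>" "1 / enn2real \<tau> \<le> 1"
    proof -
      show "1 / enn2real \<tau> \<le> 1"
        using exponents(1) by (cases \<tau>) auto
    qed simp
    then have "\<theta> / 2 \<le> (\<theta> / 2) powr (1 / enn2real \<tau>)"
      using powr_mono'[of "1 / enn2real \<tau>" 1 "\<theta> / 2"] \<open>0 < \<theta>\<close> \<open>\<theta> \<le> 1\<close> by simp
    then have "\<theta> / 2 * N powr (1 / enn2real \<tau>) \<le> (\<theta> / 2 * N) powr (1 / enn2real \<tau>)"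
      using N \<open>0 < \<theta>\<close> by (subst powr_mult) (auto intro!: mult_right_mono)
    also have "\<dots> \<le> (real (card M) / 2) powr (1 / enn2real \<tau>)"
      using l(2) N \<open>0 < \<theta>\<close> by (intro powr_mono2) (auto simp: M_def N_def)
    finally show "\<theta> / 2 * N powr (1 / enn2real \<tau>) \<le> (real (card M) / 2) powr (1 / enn2real \<tau>)" .
  qed
  moreover have "c * (\<theta> / 2 * N powr (1 / enn2real \<tau>)) =
      (a - 1) * (1 - b) * \<theta> / (4 * S) * (R * b ^ l * \<Lambda>)"
    using N S by (simp add: c_def s_def powr_minus field_simps)
  ultimately show ?thesis using l(1) unfolding \<Lambda>_def by (metis order_trans)
qed

section \<open>The upper bound for the adaptive algorithm\<close>

lemma sigma_le_ball:
  assumes "1 \<le> \<rho>" "0 \<le> R" "f \<in> input_ball \<rho> lam R"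
  shows "sigma \<rho> lam k n j f \<le> R"
proof -
  have "lp_enorm \<rho> (K j) (\<lambda>x. f x /\<^sub>R lam x) \<le> input_norm \<rho> lam f"
    unfolding input_norm_def by (rule lp_enorm_mono) auto
  also have "\<dots> \<le> ennreal R" using assms by (simp add: input_ball_def)
  finally show ?thesis
    unfolding sigma_def lp_norm_def using \<open>0 \<le> R\<close> enn2real_mono[of _ "ennreal R"] by simp
qed

text \<open>The cone condition from level \<open>1\<close> to level \<open>j\<close> bounds \<open>\<sigma>\<^sub>j(f)\<close> by \<open>a * b ^ (j - 1) * R\<close>; level \<open>1\<close> is the
  first one that the cone condition constrains. The tail norm is at most a geometric series times
  \<open>\<alpha> * \<Lambda>\<^sub>j\<close>.\<close>

lemma ERR_le:
  assumes "1 \<le> \<tau>" "1 \<le> \<rho>" "1 \<le> \<rho>'" and ab: "1 < a" "0 < b" "b < 1" and "0 \<le> R" "1 \<le> \<alpha>"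
    and tail: "\<And>r. Lam \<rho>' lam k n (j + r) \<le> \<alpha> * Lam \<rho>' lam k n j"
    and "1 \<le> j" and f: "f \<in> decay_cone a b \<rho> lam k n" "f \<in> input_ball \<rho> lam R"
  shows "ERR a b \<tau> \<rho> \<rho>' lam k n j f \<le> a\<^sup>2 * \<alpha> / (1 - b) * (R * b ^ (j - 1) * Lam \<rho>' lam k n j)"
proof -
  define \<Lambda> where "\<Lambda> = Lam \<rho>' lam k n j"
  have L0: "0 \<le> Lam \<rho>' lam k n i" for i by (simp add: Lam_def lp_norm_nonneg)
  have "sigma \<rho> lam k n j f \<le> a * b ^ (j - 1) * R"
  proof (cases "j = 1")
    case True
    have "sigma \<rho> lam k n 1 f \<le> R" using assms by (intro sigma_le_ball)
    also have "\<dots> \<le> a * R" using ab \<open>0 \<le> R\<close> by (simp add: mult_le_cancel_right1)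
    finally show ?thesis using True by simp
  next
    case False
    then have "sigma \<rho> lam k n (1 + (j - 1)) f \<le> a * b ^ (j - 1) * sigma \<rho> lam k n 1 f"
      using f(1)[unfolded decay_cone_def, THEN CollectD, THEN conjunct2, rule_format, of 1 "j - 1"]
        \<open>1 \<le> j\<close> by linarith
    also have "\<dots> \<le> a * b ^ (j - 1) * R"
      using sigma_le_ball[OF _ _ f(2)] assms by (intro mult_left_mono) auto
    finally show ?thesis using \<open>1 \<le> j\<close> by simp
  qed
  moreover have "lp_norm \<tau> {1..} (\<lambda>r. b ^ r * Lam \<rho>' lam k n (j + r)) \<le> \<alpha> * \<Lambda> / (1 - b)"
  proof -
    have "lp_enorm \<tau> {1..} (\<lambda>r. b ^ r * Lam \<rho>' lam k n (j + r)) \<le> lp_enorm \<tau> {1..} (\<lambda>r. \<alpha> * \<Lambda> * b ^ r)"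
    proof (rule lp_enorm_mono)
      fix r :: nat
      have "b ^ r * Lam \<rho>' lam k n (j + r) \<le> b ^ r * (\<alpha> * \<Lambda>)"
        using tail[of r] ab by (intro mult_left_mono) (auto simp: \<Lambda>_def)
      then have "norm (b ^ r * Lam \<rho>' lam k n (j + r)) \<le> \<alpha> * \<Lambda> * b ^ r"
        using L0[of "j + r"] ab by (simp add: abs_mult mult.commute)
      then show "norm (b ^ r * Lam \<rho>' lam k n (j + r)) \<le> norm (\<alpha> * \<Lambda> * b ^ r)"
        by (rule order_trans) simp
    qed simp
    also have "\<dots> \<le> ennreal (\<alpha> * \<Lambda> / (1 - b))"
      using assms L0[of j] by (intro lp_enorm_geometric) (auto simp: \<Lambda>_def)
    finally show ?thesis
      using assms L0[of j] enn2real_mono[of _ "ennreal (\<alpha> * \<Lambda> / (1 - b))"]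
      by (simp add: lp_norm_def \<Lambda>_def)
  qed
  ultimately have "sigma \<rho> lam k n j f * lp_norm \<tau> {1..} (\<lambda>r. b ^ r * Lam \<rho>' lam k n (j + r))
      \<le> (a * b ^ (j - 1) * R) * (\<alpha> * \<Lambda> / (1 - b))"
    using assms by (intro mult_mono) (auto simp: lp_norm_nonneg)
  from mult_left_mono[OF this, of a] show ?thesis
    using ab by (simp add: ERR_def \<Lambda>_def power2_eq_square mult_ac)
qed

end


section \<open>Essential optimality\<close>

theorem theorem8:
  fixes \<tau> \<rho> \<rho>' :: ennreal
    and lam :: "'k \<Rightarrow> real"
    and k :: "nat \<Rightarrow> 'k"
    and n :: "nat \<Rightarrow> nat"
    and a b S\<^sub>1 S\<^sub>2 :: real
    and C :: "('k \<Rightarrow> 'c::{real_normed_field,banach}) set"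
  assumes "1 \<le> \<tau>" and "\<tau> \<le> \<rho>" and "1 / \<rho> + 1 / \<rho>' = 1 / \<tau>"
    and "\<And>x. 0 < lam x"
    and "bij_betw k {1..} UNIV"
    and "\<And>i. 1 \<le> i \<Longrightarrow> lam (k (i + 1)) \<le> lam (k i)"
    and "lp_enorm \<rho>' UNIV lam < \<infinity>"
    and "strict_mono n"
    and "0 < b" and "b < 1" and "1 < a"
    and C_def: "C = decay_cone a b \<rho> lam k n"
    and "\<exists>\<alpha> \<beta> \<gamma> :: real. 0 < \<beta> \<and> \<beta> < 1 \<and> 0 < \<gamma> \<and> \<gamma> < 1 \<and> 1 \<le> \<alpha> \<and>
      (\<forall>j r. inverse \<alpha> * \<beta> ^ r * Lam \<rho>' lam k n j \<le> Lam \<rho>' lam k n (j + r) \<and>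
             Lam \<rho>' lam k n (j + r) \<le> \<alpha> * \<gamma> ^ r * Lam \<rho>' lam k n j)"
    and "\<And>j. 1 \<le> j \<Longrightarrow> lam (k (n (j - 1) + 1)) / lam (k (n j)) \<le> S\<^sub>1"
    and "0 < S\<^sub>2"
    and "\<And>j J. 1 \<le> j \<Longrightarrow> finite J \<Longrightarrow> card J \<le> n j \<Longrightarrow>
      S\<^sub>2 \<le> (MAX l\<in>{0..j + 1}. real (card (block k n l - J)) / real (card (block k n l)))"
  shows "\<exists>\<omega>>0. \<exists>\<epsilon>\<^sub>m\<^sub>a\<^sub>x>0. \<exists>R\<^sub>m\<^sub>i\<^sub>n>0. \<forall>\<epsilon> R. 0 < \<epsilon> \<and> \<epsilon> \<le> \<epsilon>\<^sub>m\<^sub>a\<^sub>x \<and> R\<^sub>m\<^sub>i\<^sub>n \<le> R \<longrightarrow>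
    COST \<rho> lam (ALG a b \<tau> \<rho> \<rho>' lam k n) C \<epsilon> R \<le> COMP \<tau> \<rho> lam C (\<omega> * \<epsilon>) R"
proof -
  interpret enumerated_blocks k n by unfold_locales (fact assms)+
  have lam: "0 < lam x" for x by fact
  have ab: "0 < b" "b < 1" "1 < a" by fact+
  note \<rho>' = conjugate_exponents[OF assms(1-3)]
  have "1 \<le> \<rho>" using assms(1,2) by (rule order_trans)
  define \<Lambda> where "\<Lambda> j = Lam \<rho>' lam k n j" for j
  obtain \<alpha> \<beta> \<gamma> :: real where \<beta>: "0 < \<beta>" "\<beta> < 1" and \<gamma>: "0 < \<gamma>" "\<gamma> < 1" and \<alpha>: "1 \<le> \<alpha>"
    and \<Lambda>_ge: "\<And>j r. inverse \<alpha> * \<beta> ^ r * \<Lambda> j \<le> \<Lambda> (j + r)"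
    and \<Lambda>_le': "\<And>j r. \<Lambda> (j + r) \<le> \<alpha> * \<gamma> ^ r * \<Lambda> j"
    using assms(13) unfolding \<Lambda>_def by blast
  \<comment> \<open>An empty block \<open>K 0\<close> would have \<open>\<Lambda> 0 = 0\<close>, and (a) would then force \<open>\<Lambda> 1 = 0\<close>.\<close>
  have n0: "0 < n 0"
  proof (rule ccontr)
    assume "\<not> 0 < n 0"
    then have "\<Lambda> 0 \<le> 0"
      using lp_norm_le_const[OF finite_block \<rho>'(1) order_refl, of 0 lam]
      by (simp add: \<Lambda>_def Lam_def block_def)
    then have "\<alpha> * \<gamma> ^ 1 * \<Lambda> 0 \<le> 0" using \<alpha> \<gamma> by (intro mult_nonneg_nonpos) auto
    then have "\<Lambda> 1 \<le> 0" using \<Lambda>_le'[of 0 1] by simp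
    moreover have "0 < \<Lambda> 1"
      unfolding \<Lambda>_def using \<rho>'(1) lam by (intro Lam_pos) auto
    ultimately show False by simp
  qed
  then have \<Lambda>_pos: "0 < \<Lambda> j" for j
    unfolding \<Lambda>_def using \<rho>'(1) lam by (intro Lam_pos) auto
  have \<Lambda>_le: "\<Lambda> (j + r) \<le> \<alpha> * \<Lambda> j" for j r
  proof -
    have "\<alpha> * \<gamma> ^ r * \<Lambda> j \<le> \<alpha> * 1 * \<Lambda> j"
      using \<alpha> \<gamma> \<Lambda>_pos[of j] by (intro mult_right_mono mult_left_mono power_le_one) auto
    then show ?thesis using \<Lambda>_le'[of j r] by simp
  qed

  have antimono: "lam (k j) \<le> lam (k i)" if "1 \<le> i" "i \<le> j" for i j
    using that(2)
  proof (induction j rule: dec_induct)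
    case (step j)
    then show ?case using assms(6)[of j] that(1) by auto
  qed simp
  \<comment> \<open>Condition (b) starts at level \<open>1\<close>, but (c) may single out block \<open>0\<close> as well.\<close>
  define S where "S = max S\<^sub>1 (lam (k 1) / lam (k (n 0)))"
  have S: "0 < S" using lam by (simp add: S_def less_max_iff_disj)
  have ratio: "lam x \<le> S * lam y" if "x \<in> K l" "y \<in> K l" for l x y
  proof -
    define lo where "lo = (if l = 0 then 0 else n (l - 1))"
    have "x \<in> k ` {lo + 1..n l}" "y \<in> k ` {lo + 1..n l}"
      using that unfolding block_def lo_def by blast+
    then obtain i i' where i: "x = k i" "lo + 1 \<le> i" "y = k i'" "i' \<le> n l" "lo + 1 \<le> i'"
      by auto
    have "lam (k (lo + 1)) / lam (k (n l)) \<le> S"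
      using assms(14)[of l] by (cases "l = 0") (auto simp: S_def lo_def)
    then have "lam (k (lo + 1)) \<le> S * lam (k (n l))"
      using lam by (simp add: divide_le_eq)
    moreover have "lam x \<le> lam (k (lo + 1))" "lam (k (n l)) \<le> lam y"
      using i by (auto intro!: antimono)
    ultimately show ?thesis
      using mult_left_mono[of "lam (k (n l))" "lam y" S] S by linarith
  qed
  have missed: "\<exists>l\<le>j + 1. S\<^sub>2 * real (card (K l)) \<le> real (card (K l - J))"
    if "1 \<le> j" "finite J" "card J \<le> n j" for j J
  proof -
    have "\<exists>l\<in>{0..j + 1}. S\<^sub>2 \<le> real (card (K l - J)) / real (card (K l))"
      using assms(16)[OF that] by (subst (asm) Max_ge_iff) auto
    then obtain l where l: "l \<le> j + 1" "S\<^sub>2 \<le> real (card (K l - J)) / real (card (K l))"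
      by auto
    have "0 < card (K l)"
      using n0 finite_block block_nonempty by (auto simp: card_gt_0_iff)
    then show ?thesis using l by (auto simp: field_simps)
  qed

  \<comment> \<open>Division by \<open>b\<^sup>2\<close> turns \<open>b ^ (j - 1)\<close> into \<open>b ^ (j + 1)\<close>, the power belonging to the level after
    \<open>j\<close>, at which the algorithm stops.\<close>
  define D where "D = a\<^sup>2 * \<alpha> / (1 - b) / b\<^sup>2"
  have D: "0 < D" using ab \<alpha> by (simp add: D_def)
  have ERR: "ERR a b \<tau> \<rho> \<rho>' lam k n j f \<le> D * (R * b ^ (j + 1) * \<Lambda> j)"
    if "1 \<le> j" "0 \<le> R" "f \<in> C" "f \<in> input_ball \<rho> lam R" for f j R
  proof -
    have "b ^ (j + 1) = b\<^sup>2 * b ^ (j - 1)"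
      using that(1) by (simp flip: power_add)
    then have "D * (R * b ^ (j + 1) * \<Lambda> j) = a\<^sup>2 * \<alpha> / (1 - b) * (R * b ^ (j - 1) * \<Lambda> j)"
      using ab by (simp add: D_def)
    then show ?thesis
      using ERR_le[OF assms(1) \<open>1 \<le> \<rho>\<close> \<rho>'(1) ab(3,1,2) that(2) \<alpha> _ that(1), of lam f] that \<Lambda>_le[of j]
      by (simp add: \<Lambda>_def C_def)
  qed

  \<comment> \<open>\<open>E\<close> is the loss in the fooling argument, \<open>G\<close> the loss in passing from level \<open>j\<close> to the level
    that (c) singles out; the \<open>2\<close> in \<open>\<omega>\<close> makes the final contradiction strict.\<close>
  define E where "E = (a - 1) * (1 - b) * S\<^sub>2 / (4 * S)"
  define G where "G = b * \<beta>\<^sup>2 / \<alpha>"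
  define \<omega> where "\<omega> = E * G / (2 * D)"
  define \<epsilon>\<^sub>m\<^sub>a\<^sub>x where "\<epsilon>\<^sub>m\<^sub>a\<^sub>x = D * b * \<Lambda> 0"
  have pos: "0 < E" "0 < G" using ab S \<open>0 < S\<^sub>2\<close> \<alpha> \<beta> by (auto simp: E_def G_def)
  then have "0 < \<omega>" using D by (simp add: \<omega>_def)
  have "0 < \<epsilon>\<^sub>m\<^sub>a\<^sub>x" using D ab \<Lambda>_pos[of 0] by (simp add: \<epsilon>\<^sub>m\<^sub>a\<^sub>x_def)
  \<comment> \<open>At most two steps lead from \<open>j\<close> up to \<open>l\<close>, so there \<open>\<Lambda>\<close> loses at most the factor \<open>\<beta>\<^sup>2 / \<alpha>\<close>; at
    levels below \<open>j\<close> it loses at most \<open>1 / \<alpha>\<close>. The \<open>b\<close> in \<open>G\<close> covers the step from \<open>j + 1\<close> to \<open>j + 2\<close>.\<close>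
  have blocks_ge: "G * (b ^ (j + 1) * \<Lambda> j) \<le> b ^ l * \<Lambda> l" if "l \<le> j + 2" for j l
  proof -
    have "b * b ^ (j + 1) \<le> b ^ l"
      using power_decreasing[OF that, of b] ab by simp
    moreover have "\<beta>\<^sup>2 / \<alpha> * \<Lambda> j \<le> \<Lambda> l"
    proof (cases "l \<le> j")
      case True
      have "\<beta>\<^sup>2 * \<Lambda> j \<le> 1 * \<Lambda> j"
        using \<beta> \<Lambda>_pos[of j] by (intro mult_right_mono power_le_one) auto
      also have "\<dots> \<le> \<alpha> * \<Lambda> l" using \<Lambda>_le[of l "j - l"] True by simp
      finally show ?thesis using \<alpha> by (simp add: field_simps)
    next
      case False
      have "\<beta>\<^sup>2 \<le> \<beta> ^ (l - j)"
        using that \<beta> by (intro power_decreasing) auto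
      then have "\<beta>\<^sup>2 / \<alpha> * \<Lambda> j \<le> inverse \<alpha> * \<beta> ^ (l - j) * \<Lambda> j"
        using \<alpha> \<Lambda>_pos[of j] by (auto simp: field_simps)
      then show ?thesis using \<Lambda>_ge[of "l - j" j] False by simp
    qed
    ultimately have "(b * b ^ (j + 1)) * (\<beta>\<^sup>2 / \<alpha> * \<Lambda> j) \<le> b ^ l * \<Lambda> l"
      using ab \<alpha> \<Lambda>_pos[of j] by (intro mult_mono) auto
    then show ?thesis by (simp add: G_def mult_ac)
  qed

  have "COST \<rho> lam (ALG a b \<tau> \<rho> \<rho>' lam k n) C \<epsilon> R \<le> COMP \<tau> \<rho> lam C (\<omega> * \<epsilon>) R"
    if \<epsilon>: "0 < \<epsilon>" "\<epsilon> \<le> \<epsilon>\<^sub>m\<^sub>a\<^sub>x" and R: "1 \<le> R" for \<epsilon> R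
    unfolding COST_def[of _ _ "ALG a b \<tau> \<rho> \<rho>' lam k n"] COMP_def
  proof (intro SUP_least INF_greatest)
    fix f :: "'k \<Rightarrow> 'c" and A :: "('k, 'c) algorithm"
    assume f: "f \<in> C \<inter> input_ball \<rho> lam R" and A: "A \<in> admissible \<tau> C"
    let ?stops = "\<lambda>j. 1 \<le> j \<and> ERR a b \<tau> \<rho> \<rho>' lam k n j f \<le> \<epsilon>"
    have ex: "\<exists>j\<ge>1. ERR a b \<tau> \<rho> \<rho>' lam k n j f \<le> \<epsilon>"
    proof -
      define B where "B = D * R * (\<alpha> * \<Lambda> 0)"
      have "0 < B" using D R \<alpha> \<Lambda>_pos[of 0] by (simp add: B_def)
      obtain j where j: "b ^ j < \<epsilon> / B"
        using real_arch_pow_inv[of "\<epsilon> / B" b] \<epsilon> ab \<open>0 < B\<close> by auto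
      have "ERR a b \<tau> \<rho> \<rho>' lam k n (j + 1) f \<le> D * (R * b ^ (j + 1 + 1) * \<Lambda> (j + 1))"
        using f R by (intro ERR) auto
      also have "\<dots> \<le> D * (R * b ^ j * (\<alpha> * \<Lambda> 0))"
        using D R \<Lambda>_le[of 0 "j + 1"] ab \<Lambda>_pos[of "j + 1"]
        by (intro mult_left_mono mult_mono power_decreasing) auto
      also have "\<dots> \<le> \<epsilon>" using j \<open>0 < B\<close> by (simp add: B_def field_simps)
      finally show ?thesis by (intro exI[of _ "j + 1"]) simp
    qed
    define J where "J = (LEAST j. ?stops j)"
    have J: "?stops J"
      unfolding J_def using LeastI_ex[of ?stops] ex by blast
    then obtain j where j: "J = j + 1" by (metis add.commute le_Suc_ex)
    have \<epsilon>_le: "\<epsilon> \<le> D * (R * b ^ (j + 1) * \<Lambda> j)"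
    proof (cases "j = 0")
      case True
      have "\<epsilon>\<^sub>m\<^sub>a\<^sub>x * 1 \<le> \<epsilon>\<^sub>m\<^sub>a\<^sub>x * R"
        using R \<open>0 < \<epsilon>\<^sub>m\<^sub>a\<^sub>x\<close> by (intro mult_left_mono) auto
      then show ?thesis using True \<epsilon> by (simp add: \<epsilon>\<^sub>m\<^sub>a\<^sub>x_def mult_ac)
    next
      case False
      then have "\<not> ?stops j"
        using not_less_Least[of j ?stops] j by (simp add: J_def)
      then have "\<epsilon> < ERR a b \<tau> \<rho> \<rho>' lam k n j f" using False by auto
      also have "\<dots> \<le> D * (R * b ^ (j + 1) * \<Lambda> j)"
        using False f R by (intro ERR) auto
      finally show ?thesis by simp
    qed
    have "alg_cost (ALG a b \<tau> \<rho> \<rho>' lam k n) f \<epsilon> = enat (n J)"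
      unfolding J_def by (intro ALG_cost assms(5) assms(8) ex)
    also have "\<dots> \<le> COST \<rho> lam A C (\<omega> * \<epsilon>) R"
    proof (rule ccontr)
      assume "\<not> enat (n J) \<le> COST \<rho> lam A C (\<omega> * \<epsilon>) R"
      then have cheap: "COST \<rho> lam A (decay_cone a b \<rho> lam k n) (\<omega> * \<epsilon>) R \<le> enat (n J)"
        by (simp add: C_def)
      have "\<exists>l\<le>J + 1. E * (R * b ^ l * Lam \<rho>' lam k n l) \<le> \<omega> * \<epsilon>"
        unfolding E_def
        using n0 lam assms(1) \<open>1 \<le> \<rho>\<close> \<rho>' ab R \<epsilon> \<open>0 < \<omega>\<close> S ratio \<open>0 < S\<^sub>2\<close> missed J A cheap
        by (intro tolerance_lower_bound[where m = "n J" and A = A]) (auto simp: C_def)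
      then obtain l where l: "l \<le> j + 2" "E * (R * b ^ l * \<Lambda> l) \<le> \<omega> * \<epsilon>"
        by (auto simp: \<Lambda>_def j)
      have "2 * (\<omega> * \<epsilon>) = E * G / D * \<epsilon>" by (simp add: \<omega>_def)
      also have "\<dots> \<le> E * G / D * (D * (R * b ^ (j + 1) * \<Lambda> j))"
        using pos D \<epsilon>_le by (intro mult_left_mono) auto
      also have "\<dots> = E * R * (G * (b ^ (j + 1) * \<Lambda> j))"
        using D by simp
      also have "\<dots> \<le> E * R * (b ^ l * \<Lambda> l)"
        using pos R blocks_ge[OF l(1)] by (intro mult_left_mono) auto
      also have "\<dots> \<le> \<omega> * \<epsilon>" using l(2) by (simp add: mult_ac)
      finally show False using \<open>0 < \<omega>\<close> \<epsilon> by simp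
    qed
    finally show "alg_cost (ALG a b \<tau> \<rho> \<rho>' lam k n) f \<epsilon> \<le> COST \<rho> lam A C (\<omega> * \<epsilon>) R" .
  qed
  then show ?thesis
    using \<open>0 < \<omega>\<close> \<open>0 < \<epsilon>\<^sub>m\<^sub>a\<^sub>x\<close> by (intro exI[of _ \<omega>] exI[of _ \<epsilon>\<^sub>m\<^sub>a\<^sub>x] exI[of _ 1] conjI) auto
qed

end
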